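(* Let $0<c<\lambda$ be real and consider the real scalar system $$u''+u'+\lambda u+cv=0,\qquad v''+\lambda v+cu=0. \qquad (S)$$ As $\frac{c}{\lambda}$ tends to $0$ and $\frac{c}{\lambda^{1/2}}$ tends to infinity, the logarithmic decrement of $(S)$ (as evaluated by the Liapunov function method described in the context) tends to the highest possible value $\frac14$.
   Context: Let $T(t)$, $t\ge0$, be the linear semigroup on $\mathbb{R}^4$ mapping $(u(0),v(0),u'(0),v'(0))$ to $(u(t),v(t),u'(t),v'(t))$ for solutions of $(S)$. The logarithmic decrement of $(S)$ is the upper bound of the set of $\gamma>0$ for which $e^{\gamma t}\|T(t)\|$ is bounded for $t\ge0$; it never exceeds $\frac14$. The Liapunov function method: for $p>1$ and $\varepsilon>0$ small, put $$H_\varepsilon=\tfrac12\left[u'^2+v'^2+\lambda(u^2+v^2)\right]+cuv-\varepsilon vv'+p\varepsilon uu'+\frac{(p+1)\lambda\varepsilon}{2c}(u'v-uv').$$ Along solutions of $(S)$, $$H_\varepsilon'=-(1-p\varepsilon)u'^2-\varepsilon v'^2-\varepsilon u'\Big(pu+\frac{(p+1)\lambda}{2c}v\Big)-\varepsilon\frac{p-1}{2}\left[\lambda(u^2+v^2)+2cuv\right].$$ One uses $\lambda(u^2+v^2)+2cuv\ge(\lambda-c)(u^2+v^2)$, and bounds $\big|u'\big(pu+\frac{(p+1)\lambda}{2c}v\big)\big|$ by Young's inequality by a fraction of $\frac{p-1}{2}(\lambda-c)(u^2+v^2)$ plus a constant times $u'^2$. For $\varepsilon$ small this shows that $H_\varepsilon$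 is a strict Liapunov function, and it yields a differential inequality $H_\varepsilon'\le-\delta H_\varepsilon$ with $\delta>0$. Since $H_\varepsilon$ is comparable to the square of the norm of the solution, the resulting evaluation of the logarithmic decrement is $\delta/2$. *)

theory Defs
  imports "HOL-Analysis.Analysis"
begin

text \<open>
  A solution of the system \<open>(S)\<close> on \<open>[0, \<infinity>)\<close>, given together with the first derivatives \<open>u'\<close>, \<open>v'\<close>;
  the numbers \<open>a\<close> and \<open>b\<close> are the second derivatives. Derivatives at \<open>0\<close> are one-sided.
\<close>

definition solution ::
  "real \<Rightarrow> real \<Rightarrow> (real \<Rightarrow> real) \<Rightarrow> (real \<Rightarrow> real) \<Rightarrow> (real \<Rightarrow> real) \<Rightarrow> (real \<Rightarrow> real) \<Rightarrow> bool" where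
  "solution c lam u v u' v' \<longleftrightarrow>
    (\<forall>t\<ge>0. (u has_real_derivative u' t) (at t within {0..}) \<and>
           (v has_real_derivative v' t) (at t within {0..}) \<and>
           (\<exists>a b. (u' has_real_derivative a) (at t within {0..}) \<and>
                  (v' has_real_derivative b) (at t within {0..}) \<and>
                  a + u' t + lam * u t + c * v t = 0 \<and>
                  b + lam * v t + c * u t = 0))"

definition state ::
  "(real \<Rightarrow> real) \<Rightarrow> (real \<Rightarrow> real) \<Rightarrow> (real \<Rightarrow> real) \<Rightarrow> (real \<Rightarrow> real) \<Rightarrow> real \<Rightarrow> real ^ 4" where
  "state u v u' v' t = vector [u t, v t, u' t, v' t]"

text \<open>The description is meaningful because \<open>(S)\<close> is a linear system with constant coefficients,
  so that every initial state has exactly one solution on \<open>[0, \<infinity>)\<close>.\<close>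

definition semigroup_S :: "real \<Rightarrow> real \<Rightarrow> real \<Rightarrow> real ^ 4 \<Rightarrow> real ^ 4" where
  "semigroup_S c lam t x =
    (THE y. \<exists>u v u' v'. solution c lam u v u' v' \<and> state u v u' v' 0 = x \<and> state u v u' v' t = y)"

text \<open>For \<open>0 < c < \<lambda>\<close> the set below is nonempty (the system is exponentially stable) and bounded above
  by \<open>1/4\<close>, so the real supremum is the intended one.\<close>

definition log_decrement :: "real \<Rightarrow> real \<Rightarrow> real" where
  "log_decrement c lam =
    Sup {\<gamma>. \<gamma> > 0 \<and> bounded ((\<lambda>t. exp (\<gamma> * t) * onorm (semigroup_S c lam t)) ` {0..})}"

definition liapunov_H :: "real \<Rightarrow> real \<Rightarrow> real \<Rightarrow> real \<Rightarrow> real ^ 4 \<Rightarrow> real" where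
  "liapunov_H c lam p eps x =
    (let u = x $ 1; v = x $ 2; u' = x $ 3; v' = x $ 4 in
      (1/2) * (u'\<^sup>2 + v'\<^sup>2 + lam * (u\<^sup>2 + v\<^sup>2)) + c * u * v - eps * v * v' + p * eps * u * u'
      + (p + 1) * lam * eps / (2 * c) * (u' * v - u * v'))"

text \<open>
  \<open>K\<close> is an admissible constant in Young's inequality when the mixed term of the derivative of
  \<open>H\<close> is bounded by the fraction \<open>\<theta>\<close> of \<open>(p - 1) / 2 * (\<lambda> - c) * (u\<^sup>2 + v\<^sup>2)\<close> plus \<open>K * u'\<^sup>2\<close>.
\<close>

definition young_bound :: "real \<Rightarrow> real \<Rightarrow> real \<Rightarrow> real \<Rightarrow> real \<Rightarrow> bool" where
  "young_bound c lam p \<theta> K \<longleftrightarrow>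
    (\<forall>u v u'. \<bar>u' * (p * u + (p + 1) * lam / (2 * c) * v)\<bar>
       \<le> \<theta> * ((p - 1) / 2 * (lam - c) * (u\<^sup>2 + v\<^sup>2)) + K * u'\<^sup>2)"

text \<open>
  The upper estimate of the derivative of \<open>H\<close> that results from the inequality
  \<open>\<lambda> (u\<^sup>2 + v\<^sup>2) + 2 c u v \<ge> (\<lambda> - c) (u\<^sup>2 + v\<^sup>2)\<close> and from Young's inequality.
\<close>

definition derivative_estimate ::
  "real \<Rightarrow> real \<Rightarrow> real \<Rightarrow> real \<Rightarrow> real \<Rightarrow> real \<Rightarrow> real ^ 4 \<Rightarrow> real" where
  "derivative_estimate c lam p eps \<theta> K x =
    (let u = x $ 1; v = x $ 2; u' = x $ 3; v' = x $ 4 in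
      - (1 - p * eps - eps * K) * u'\<^sup>2 - eps * v'\<^sup>2
      - eps * (1 - \<theta>) * ((p - 1) / 2) * (lam - c) * (u\<^sup>2 + v\<^sup>2))"

text \<open>
  The method proves the rate \<open>\<delta>\<close> when, for some choice of its parameters, \<open>H\<close> is comparable to
  the square of the norm and the estimate above gives \<open>H' \<le> - \<delta> H\<close> along all solutions.
\<close>

definition liapunov_rate :: "real \<Rightarrow> real \<Rightarrow> real \<Rightarrow> bool" where
  "liapunov_rate c lam \<delta> \<longleftrightarrow> \<delta> > 0 \<and>
    (\<exists>p eps \<theta> K. p > 1 \<and> eps > 0 \<and> 0 < \<theta> \<and> \<theta> < 1 \<and> young_bound c lam p \<theta> K \<and>
      (\<exists>m>0. \<exists>M>0. \<forall>x. m * (norm x)\<^sup>2 \<le> liapunov_H c lam p eps x \<and>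
                        liapunov_H c lam p eps x \<le> M * (norm x)\<^sup>2) \<and>
      (\<forall>u v u' v'. solution c lam u v u' v' \<longrightarrow>
        (\<forall>t\<ge>0. \<exists>D.
          ((\<lambda>s. liapunov_H c lam p eps (state u v u' v' s)) has_real_derivative D)
            (at t within {0..}) \<and>
          D \<le> derivative_estimate c lam p eps \<theta> K (state u v u' v' t) \<and>
          derivative_estimate c lam p eps \<theta> K (state u v u' v' t)
            \<le> - \<delta> * liapunov_H c lam p eps (state u v u' v' t))))"

text \<open>The best evaluation \<open>\<delta> / 2\<close> of the logarithmic decrement given by the method.\<close>

definition liapunov_decrement :: "real \<Rightarrow> real \<Rightarrow> real" where
  "liapunov_decrement c lam = Sup {\<delta> / 2 | \<delta>. liapunov_rate c lam \<delta>}"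

end

theory Submission
  imports Defs "HOL-Computational_Algebra.Fundamental_Theorem_Algebra"
begin

text \<open>
  Let \<open>E = (u'\<^sup>2 + v'\<^sup>2 + \<lambda> (u\<^sup>2 + v\<^sup>2)) / 2\<close>. By the inequality of arithmetic and geometric means,
  \<open>\<bar>H - E\<bar> \<le> \<eta> E\<close> with \<open>\<eta>\<close> built from \<open>c / \<lambda>\<close>, \<open>1 / \<surd>\<lambda>\<close> and \<open>\<surd>\<lambda> / c\<close>, all of which tend
  to \<open>0\<close>; the same holds for the Young constant at a fixed fraction \<open>\<theta>\<close>. With \<open>p = 3\<close> and
  \<open>\<epsilon> = 1/4\<close> the derivative of \<open>H\<close> is then at most about \<open>- (1 - \<theta>) / 2\<close> times \<open>H\<close>, so the
  method gives rates \<open>\<delta> / 2\<close> arbitrarily close to \<open>1/4\<close>.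
  Conversely the roots of the characteristic polynomial \<open>(s\<^sup>2 + s + \<lambda>) (s\<^sup>2 + \<lambda>) - c\<^sup>2\<close> have sum
  \<open>- 1\<close>, so one of them has real part at least \<open>- 1/4\<close>, and the corresponding exponential
  solutions exclude decay faster than \<open>exp (- t / 4)\<close>.
\<close>

section \<open>Coordinates of states, and comparison of \<open>liapunov_H\<close> with the
  energy\<close>

lemma vector_4 [simp]:
  "(vector [x, y, z, w] :: ('a::zero)^4) $ 1 = x"
  "(vector [x, y, z, w] :: ('a::zero)^4) $ 2 = y"
  "(vector [x, y, z, w] :: ('a::zero)^4) $ 3 = z"
  "(vector [x, y, z, w] :: ('a::zero)^4) $ 4 = w"
  unfolding vector_def by simp_all

lemma state_nth [simp]:
  "state u v u' v' t $ 1 = u t" "state u v u' v' t $ 2 = v t"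
  "state u v u' v' t $ 3 = u' t" "state u v u' v' t $ 4 = v' t"
  by (simp_all add: state_def)

lemma norm_real_4: "(norm (x :: real ^ 4))\<^sup>2 = (x $ 1)\<^sup>2 + (x $ 2)\<^sup>2 + (x $ 3)\<^sup>2 + (x $ 4)\<^sup>2"
  by (simp add: norm_vec_def L2_set_def sum_4)

lemma abs_mult_le_half_squares: "\<bar>a * b\<bar> \<le> (a\<^sup>2 + b\<^sup>2) / 2" for a b :: real
  using zero_le_power2[of "a - b"] zero_le_power2[of "a + b"]
  by (simp add: abs_le_iff power2_sum power2_diff)

definition energy :: "real \<Rightarrow> real ^ 4 \<Rightarrow> real" where
  "energy lam x = ((x $ 3)\<^sup>2 + (x $ 4)\<^sup>2 + lam * ((x $ 1)\<^sup>2 + (x $ 2)\<^sup>2)) / 2"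

text \<open>The summand \<open>c / lam\<close> accounts for the coupling term
  \<open>c * u * v\<close>, the rest for the \<open>eps\<close> terms. There the coefficient
  \<open>p\<close> also covers the coefficient \<open>1\<close> of \<open>v * v'\<close>, and the
  division by \<open>sqrt lam\<close> converts products of a position and a velocity into
  energy.\<close>

definition perturbation_ratio :: "real \<Rightarrow> real \<Rightarrow> real \<Rightarrow> real \<Rightarrow> real" where
  "perturbation_ratio c lam p eps = c / lam + eps * (p + (p + 1) * lam / (2 * c)) / sqrt lam"

lemma energy_nonneg: "0 < lam \<Longrightarrow> 0 \<le> energy lam x"
  by (simp add: energy_def)

text \<open>Each product of a position and a velocity is bounded by weighted AM-GM. The pairs
  \<open>(u, u')\<close> and \<open>(v, v')\<close> together use up the energy exactly once, and so
  do \<open>(v, u')\<close> and \<open>(u, v')\<close>; hence the coefficients \<open>p\<close> and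
  \<open>k\<close> simply add.\<close>

lemma liapunov_H_energy:
  assumes "0 < c" "c < lam" "1 \<le> p" "0 \<le> eps"
  shows "\<bar>liapunov_H c lam p eps x - energy lam x\<bar> \<le> perturbation_ratio c lam p eps * energy lam x"
proof -
  define u v a b where uvab: "u = x $ 1" "v = x $ 2" "a = x $ 3" "b = x $ 4"
  define s where "s = sqrt lam"
  define k where "k = (p + 1) * lam / (2 * c)"
  define E where "E = energy lam x"
  have s: "s > 0" "s\<^sup>2 = lam" using assms by (simp_all add: s_def)
  have k: "k \<ge> 0" using assms by (simp add: k_def)
  have E: "E = (a\<^sup>2 + b\<^sup>2 + lam * (u\<^sup>2 + v\<^sup>2)) / 2"
    by (simp add: E_def energy_def uvab)
  have *: "s * \<bar>y * z\<bar> \<le> (lam * y\<^sup>2 + z\<^sup>2) / 2" for y z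
    using abs_mult_le_half_squares[of "s * y" z] s
    by (simp add: power_mult_distrib abs_mult)
  have "\<bar>c * u * v\<bar> = c * \<bar>u * v\<bar>" using assms by (simp add: abs_mult)
  also have "\<dots> \<le> c * ((u\<^sup>2 + v\<^sup>2) / 2)"
    using assms abs_mult_le_half_squares by (intro mult_left_mono) auto
  also have "\<dots> = c / lam * (lam * (u\<^sup>2 + v\<^sup>2) / 2)" using assms by simp
  also have "\<dots> \<le> c / lam * E" using assms unfolding E
    by (intro mult_left_mono) auto
  finally have 1: "\<bar>c * u * v\<bar> \<le> c / lam * E" .
  \<comment> \<open>Since \<open>1 \<le> p\<close>, the coefficient of \<open>v * v'\<close> may be
    raised to \<open>p\<close>, so that both products share one copy of \<open>E\<close>.\<close>
  have "s * \<bar>v * b\<bar> + p * (s * \<bar>u * a\<bar>) \<le> p * (s * \<bar>v * b\<bar> + s * \<bar>u * a\<bar>)"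
    using assms s mult_right_mono[of 1 p "s * \<bar>v * b\<bar>"] by (simp add: distrib_left)
  also have "\<dots> \<le> p * E"
    using *[of v b] *[of u a] assms by (intro mult_left_mono) (auto simp: E algebra_simps)
  finally have 2: "s * \<bar>v * b\<bar> + p * (s * \<bar>u * a\<bar>) \<le> p * E" .
  have 3: "k * (s * \<bar>a * v\<bar> + s * \<bar>u * b\<bar>) \<le> k * E"
    using *[of v a] *[of u b] k
    by (intro mult_left_mono) (auto simp: E algebra_simps)
  define R where "R = - v * b + p * u * a + k * (a * v - u * b)"
  have "s * \<bar>R\<bar> \<le> s * (\<bar>v * b\<bar> + p * \<bar>u * a\<bar> + k * (\<bar>a * v\<bar> + \<bar>u * b\<bar>))"
  proof (rule mult_left_mono)
    have "\<bar>p * u * a\<bar> = p * \<bar>u * a\<bar>" "\<bar>k * (a * v - u * b)\<bar> = k * \<bar>a * v - u * b\<bar>"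
      using assms k by (simp_all add: abs_mult)
    moreover have "k * \<bar>a * v - u * b\<bar> \<le> k * (\<bar>a * v\<bar> + \<bar>u * b\<bar>)"
      using k by (intro mult_left_mono) auto
    ultimately show "\<bar>R\<bar> \<le> \<bar>v * b\<bar> + p * \<bar>u * a\<bar> + k * (\<bar>a * v\<bar> + \<bar>u * b\<bar>)"
      unfolding R_def by linarith
  qed (use s in simp)
  also have "\<dots> \<le> (p + k) * E" using 2 3 by (simp add: algebra_simps)
  finally have "\<bar>R\<bar> \<le> (p + k) * E / s" using s by (simp add: field_simps)
  then have "eps * \<bar>R\<bar> \<le> eps * ((p + k) * E / s)" using assms by (intro mult_left_mono) auto
  then have 4: "\<bar>eps * R\<bar> \<le> eps * (p + k) / s * E" using assms by (simp add: abs_mult)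
  have "liapunov_H c lam p eps x - E = c * u * v + eps * R"
    unfolding liapunov_H_def Let_def E uvab[symmetric] R_def k_def by (simp add: algebra_simps)
  then have "\<bar>liapunov_H c lam p eps x - E\<bar> \<le> (c / lam + eps * (p + k) / s) * E"
    using 1 4 by (simp add: distrib_right)
  then show ?thesis
    by (simp add: perturbation_ratio_def s_def k_def E_def)
qed

section \<open>Young's inequality for the mixed term\<close>

text \<open>With \<open>g\<close> the allotted coefficient of \<open>u^2 + v^2\<close> and
  \<open>q = p^2 + k^2\<close>, this is \<open>q / (4 * g)\<close>, the value at which the quadratic
  form in \<open>a\<close> and the length of \<open>(u, v)\<close> has discriminant zero.\<close>

definition young_constant :: "real \<Rightarrow> real \<Rightarrow> real \<Rightarrow> real \<Rightarrow> real" where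
  "young_constant c lam p \<theta> =
    (p\<^sup>2 + ((p + 1) * lam / (2 * c))\<^sup>2) / (2 * \<theta> * (p - 1) * (lam - c))"

text \<open>Cauchy-Schwarz bounds the linear form in \<open>u\<close> and \<open>v\<close>, after
  which AM-GM with a suitable weight splits the product.\<close>

lemma young_bound_young_constant:
  assumes "c < lam" "1 < p" "0 < \<theta>"
  shows "young_bound c lam p \<theta> (young_constant c lam p \<theta>)"
  unfolding young_bound_def
proof (intro allI)
  fix u v a :: real
  define k where "k = (p + 1) * lam / (2 * c)"
  define g where "g = \<theta> * ((p - 1) / 2 * (lam - c))"
  define q where "q = p\<^sup>2 + k\<^sup>2"
  have g: "g > 0" using assms by (simp add: g_def)
  have q: "q > 0" using assms by (simp add: q_def add_pos_nonneg)
  \<comment> \<open>By Lagrange's identity this square is the defect in the Cauchy-Schwarz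
    inequality.\<close>
  have "0 \<le> (p * v - k * u)\<^sup>2" by simp
  then have w: "(p * u + k * v)\<^sup>2 \<le> q * (u\<^sup>2 + v\<^sup>2)"
    unfolding q_def power2_eq_square by (simp add: algebra_simps)
  \<comment> \<open>The weight solves \<open>r^2 * q / 2 = g\<close>, so the part in
    \<open>u^2 + v^2\<close> is exactly \<open>g\<close>, and the part in \<open>a^2\<close> becomes
    \<open>1 / (2 * r^2) = q / (4 * g)\<close>.\<close>
  define r where "r = sqrt (2 * g / q)"
  have r: "r > 0" "r\<^sup>2 = 2 * g / q" using g q by (simp_all add: r_def)
  have "\<bar>a * (p * u + k * v)\<bar> = \<bar>(a / r) * (r * (p * u + k * v))\<bar>" using r by simp
  also have "\<dots> \<le> (a\<^sup>2 / r\<^sup>2 + r\<^sup>2 * (p * u + k * v)\<^sup>2) / 2"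
    using abs_mult_le_half_squares[of "a / r" "r * (p * u + k * v)"]
    by (simp add: power_mult_distrib power_divide)
  also have "\<dots> \<le> (a\<^sup>2 / r\<^sup>2 + r\<^sup>2 * (q * (u\<^sup>2 + v\<^sup>2))) / 2"
    using w by (intro divide_right_mono add_left_mono mult_left_mono) auto
  also have "\<dots> = g * (u\<^sup>2 + v\<^sup>2) + q / (4 * g) * a\<^sup>2"
    using g q unfolding r by (simp add: field_simps)
  also have "q / (4 * g) = young_constant c lam p \<theta>"
    by (simp add: young_constant_def q_def k_def g_def mult.assoc)
  finally show "\<bar>a * (p * u + (p + 1) * lam / (2 * c) * v)\<bar>
      \<le> \<theta> * ((p - 1) / 2 * (lam - c) * (u\<^sup>2 + v\<^sup>2)) + young_constant c lam p \<theta> * a\<^sup>2"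
    by (simp add: g_def k_def mult.assoc)
qed

section \<open>Derivative of \<open>liapunov_H\<close> along solutions\<close>

text \<open>The terms \<open>p * eps * u * u'\<close> and \<open>- eps * v * v'\<close> contribute
  \<open>- p * lam * u^2\<close> and \<open>+ lam * v^2\<close> (times \<open>eps\<close>), of
  opposite signs. The last term of \<open>liapunov_H\<close> adds
  \<open>k * c * (u^2 - v^2)\<close>, and \<open>k * c = (p + 1) * lam / 2\<close> is the value that
  turns both coefficients into \<open>- (p - 1) / 2 * lam\<close>.\<close>

lemma liapunov_H_has_derivative:
  assumes "solution c lam u v u' v'" "t \<ge> 0" "c \<noteq> 0"
  shows "((\<lambda>s. liapunov_H c lam p eps (state u v u' v' s)) has_real_derivative
    - (1 - p * eps) * (u' t)\<^sup>2 - eps * (v' t)\<^sup>2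
    - eps * (u' t * (p * u t + (p + 1) * lam / (2 * c) * v t))
    - eps * ((p - 1) / 2) * (lam * ((u t)\<^sup>2 + (v t)\<^sup>2) + 2 * c * u t * v t)) (at t within {0..})"
proof -
  define k where "k = (p + 1) * lam / (2 * c)"
  have kc: "k * c = (p + 1) * lam / 2" using assms by (simp add: k_def)
  obtain a b where d [derivative_intros]:
    "(u has_real_derivative u' t) (at t within {0..})"
    "(v has_real_derivative v' t) (at t within {0..})"
    "(u' has_real_derivative a) (at t within {0..})"
    "(v' has_real_derivative b) (at t within {0..})"
    and ab: "a + u' t + lam * u t + c * v t = 0" "b + lam * v t + c * u t = 0"
    using assms unfolding solution_def by blast
  have a: "a = - u' t - lam * u t - c * v t" and b: "b = - lam * v t - c * u t"
    using ab by linarith+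
  have k_eps: "(p + 1) * lam * eps / (2 * c) = k * eps" by (simp add: k_def)
  have "((\<lambda>s. (1/2) * ((u' s)\<^sup>2 + (v' s)\<^sup>2 + lam * ((u s)\<^sup>2 + (v s)\<^sup>2)) + c * u s * v s
      - eps * v s * v' s + p * eps * u s * u' s + k * eps * (u' s * v s - u s * v' s))
    has_real_derivative
    u' t * a + v' t * b + lam * (u t * u' t + v t * v' t) + c * (u' t * v t + u t * v' t)
      - eps * (v' t * v' t + v t * b) + p * eps * (u' t * u' t + u t * a)
      + eps * k * (a * v t - u t * b)) (at t within {0..})"
    by (auto intro!: derivative_eq_intros simp: algebra_simps)
  \<comment> \<open>The last summand vanishes by \<open>kc\<close>. Keeping it makes the identity
    plain algebra, valid for every \<open>k\<close>.\<close>
  moreover have "eps * k * (a * v t - u t * b)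
      = - eps * k * u' t * v t + eps * ((p + 1) * lam / 2) * ((u t)\<^sup>2 - (v t)\<^sup>2)
        + eps * (k * c - (p + 1) * lam / 2) * ((u t)\<^sup>2 - (v t)\<^sup>2)"
    unfolding a b by (simp add: field_simps power2_eq_square)
  ultimately show ?thesis
    unfolding liapunov_H_def Let_def state_nth k_eps k_def[symmetric] kc
    by (rule_tac DERIV_cong) (auto simp: a b field_simps power2_eq_square)
qed

lemma liapunov_H_derivative_le:
  assumes "solution c lam u v u' v'" "t \<ge> 0" "0 < c" "1 < p" "0 < eps" "young_bound c lam p \<theta> K"
  shows "\<exists>D. ((\<lambda>s. liapunov_H c lam p eps (state u v u' v' s)) has_real_derivative D)
            (at t within {0..}) \<and>
          D \<le> derivative_estimate c lam p eps \<theta> K (state u v u' v' t)"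
proof (intro exI conjI)
  define Y where "Y = u' t * (p * u t + (p + 1) * lam / (2 * c) * v t)"
  define N where "N = (u t)\<^sup>2 + (v t)\<^sup>2"
  define Q where "Q = lam * N + 2 * c * u t * v t"
  show "((\<lambda>s. liapunov_H c lam p eps (state u v u' v' s)) has_real_derivative
      - (1 - p * eps) * (u' t)\<^sup>2 - eps * (v' t)\<^sup>2 - eps * Y - eps * ((p - 1) / 2) * Q)
      (at t within {0..})"
    unfolding Y_def Q_def N_def by (rule liapunov_H_has_derivative) (use assms in auto)
  have "\<bar>Y\<bar> \<le> \<theta> * ((p - 1) / 2 * (lam - c) * N) + K * (u' t)\<^sup>2"
    using assms(6) unfolding young_bound_def Y_def N_def by blast
  then have "eps * (- Y) \<le> eps * (\<theta> * ((p - 1) / 2 * (lam - c) * N) + K * (u' t)\<^sup>2)"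
    using assms by (intro mult_left_mono) auto
  moreover have "(lam - c) * N \<le> Q"
  proof -
    have "c * (- (u t * v t)) \<le> c * (N / 2)"
      using assms abs_mult_le_half_squares[of "u t" "v t"] unfolding N_def
      by (intro mult_left_mono) linarith+
    then show ?thesis by (simp add: Q_def algebra_simps)
  qed
  then have "eps * ((p - 1) / 2) * ((lam - c) * N) \<le> eps * ((p - 1) / 2) * Q"
    using assms by (intro mult_left_mono) auto
  ultimately show "- (1 - p * eps) * (u' t)\<^sup>2 - eps * (v' t)\<^sup>2 - eps * Y - eps * ((p - 1) / 2) * Q
      \<le> derivative_estimate c lam p eps \<theta> K (state u v u' v' t)"
    unfolding derivative_estimate_def Let_def state_nth N_def[symmetric]
    by (simp add: field_simps)
qed

section \<open>Parameters of the method and the rates they give\<close>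

lemma energy_comparable:
  assumes "0 < lam"
  shows "min 1 lam / 2 * (norm x)\<^sup>2 \<le> energy lam x" "energy lam x \<le> max 1 lam / 2 * (norm x)\<^sup>2"
proof -
  define N where "N = (x $ 1)\<^sup>2 + (x $ 2)\<^sup>2"
  define N' where "N' = (x $ 3)\<^sup>2 + (x $ 4)\<^sup>2"
  have n: "N \<ge> 0" "N' \<ge> 0" "(norm x)\<^sup>2 = N + N'" "energy lam x = (N' + lam * N) / 2"
    by (simp_all add: N_def N'_def norm_real_4 energy_def)
  have "min 1 lam * N \<le> lam * N" "min 1 lam * N' \<le> 1 * N'"
    "lam * N \<le> max 1 lam * N" "1 * N' \<le> max 1 lam * N'"
    using n by (intro mult_right_mono; simp)+
  then show "min 1 lam / 2 * (norm x)\<^sup>2 \<le> energy lam x" "energy lam x \<le> max 1 lam / 2 * (norm x)\<^sup>2"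
    unfolding n by (simp_all add: algebra_simps)
qed

text \<open>The conditions on \<open>r\<close> compare the derivative estimate with
  \<open>- r * energy\<close> one square at a time; velocities enter the energy with weight
  \<open>1/2\<close>, positions with \<open>lam / 2\<close>. Passing from the energy to
  \<open>liapunov_H\<close> costs the factor \<open>1 + perturbation_ratio\<close>, and a ratio
  below \<open>1\<close> keeps \<open>liapunov_H\<close> positive definite.\<close>

lemma liapunov_rateI:
  assumes c: "0 < c" "c < lam" and p: "1 < p" and eps: "0 < eps" and th: "0 < \<theta>" "\<theta> < 1"
    and ratio: "perturbation_ratio c lam p eps < 1"
    and r: "0 < r" "r / 2 \<le> 1 - p * eps - eps * young_constant c lam p \<theta>" "r / 2 \<le> eps"
      "r * lam \<le> eps * (1 - \<theta>) * (p - 1) * (lam - c)"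
  shows "liapunov_rate c lam (r / (1 + perturbation_ratio c lam p eps))"
proof -
  define \<eta> where "\<eta> = perturbation_ratio c lam p eps"
  define K where "K = young_constant c lam p \<theta>"
  have \<eta>: "0 < \<eta>" "\<eta> < 1"
    using assms unfolding \<eta>_def perturbation_ratio_def
    by (auto intro!: add_pos_pos divide_pos_pos mult_pos_pos)
  have H: "(1 - \<eta>) * energy lam x \<le> liapunov_H c lam p eps x"
    "liapunov_H c lam p eps x \<le> (1 + \<eta>) * energy lam x" for x
    using liapunov_H_energy[of c lam p eps x] c p eps unfolding \<eta>_def[symmetric]
    by (simp_all add: abs_le_iff algebra_simps)
  have est: "derivative_estimate c lam p eps \<theta> K x \<le> - (r / (1 + \<eta>)) * liapunov_H c lam p eps x" for x
  proof -
    have "r / 2 * (x $ 3)\<^sup>2 \<le> (1 - p * eps - eps * K) * (x $ 3)\<^sup>2" "r / 2 * (x $ 4)\<^sup>2 \<le> eps * (x $ 4)\<^sup>2"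
      "r * lam * ((x $ 1)\<^sup>2 + (x $ 2)\<^sup>2)
        \<le> eps * (1 - \<theta>) * (p - 1) * (lam - c) * ((x $ 1)\<^sup>2 + (x $ 2)\<^sup>2)"
      using r unfolding K_def by (intro mult_right_mono; simp)+
    then have "derivative_estimate c lam p eps \<theta> K x \<le> - r * energy lam x"
      unfolding derivative_estimate_def Let_def energy_def by (simp add: field_simps)
    also have "\<dots> = - (r / (1 + \<eta>)) * ((1 + \<eta>) * energy lam x)" using \<eta> by simp
    also have "\<dots> \<le> - (r / (1 + \<eta>)) * liapunov_H c lam p eps x"
      using H(2)[of x] \<eta> r by (intro mult_left_mono_neg) auto
    finally show ?thesis .
  qed
  have yb: "young_bound c lam p \<theta> K"
    unfolding K_def using c p th by (intro young_bound_young_constant) auto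
  have bounds: "(1 - \<eta>) * (min 1 lam / 2) * (norm x)\<^sup>2 \<le> liapunov_H c lam p eps x \<and>
      liapunov_H c lam p eps x \<le> (1 + \<eta>) * (max 1 lam / 2) * (norm x)\<^sup>2" for x
  proof -
    have "(1 - \<eta>) * (min 1 lam / 2 * (norm x)\<^sup>2) \<le> (1 - \<eta>) * energy lam x"
      "(1 + \<eta>) * energy lam x \<le> (1 + \<eta>) * (max 1 lam / 2 * (norm x)\<^sup>2)"
      using \<eta> c energy_comparable[of lam x] by (intro mult_left_mono; simp)+
    then show ?thesis using H[of x] by (simp add: mult.assoc)
  qed
  have "0 < (1 - \<eta>) * (min 1 lam / 2)" "0 < (1 + \<eta>) * (max 1 lam / 2)"
    using \<eta> c by (auto simp: max_def)
  with bounds have "\<exists>m>0. \<exists>M>0. \<forall>x. m * (norm x)\<^sup>2 \<le> liapunov_H c lam p eps x \<and>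
      liapunov_H c lam p eps x \<le> M * (norm x)\<^sup>2"
    by blast
  moreover have "\<forall>u v u' v'. solution c lam u v u' v' \<longrightarrow> (\<forall>t\<ge>0. \<exists>D.
        ((\<lambda>s. liapunov_H c lam p eps (state u v u' v' s)) has_real_derivative D)
          (at t within {0..}) \<and>
        D \<le> derivative_estimate c lam p eps \<theta> K (state u v u' v' t) \<and>
        derivative_estimate c lam p eps \<theta> K (state u v u' v' t)
          \<le> - (r / (1 + \<eta>)) * liapunov_H c lam p eps (state u v u' v' t))"
    using liapunov_H_derivative_le[OF _ _ c(1) p eps yb] est by blast
  moreover have "0 < r / (1 + \<eta>)" using r \<eta> by simp
  ultimately show ?thesis
    unfolding liapunov_rate_def \<eta>_def[symmetric] using p eps th yb by blast
qed

text \<open>As \<open>eps\<close> decreases to \<open>0\<close>, the ratio tends to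
  \<open>c / lam < 1\<close> and the coefficient of \<open>u'^2\<close> to \<open>1\<close>, so a
  small \<open>eps\<close> works for each fixed pair. The values \<open>p = 2\<close> and
  \<open>1/2\<close> for the fraction are merely convenient. The lemma makes the suprema range over
  nonempty sets, and it underlies uniqueness of solutions.\<close>

lemma liapunov_rate_exists:
  assumes "0 < c" "c < lam"
  obtains \<delta> where "liapunov_rate c lam \<delta>"
proof -
  define K where "K = young_constant c lam 2 (1/2)"
  have "((\<lambda>eps. perturbation_ratio c lam 2 eps) \<longlongrightarrow> perturbation_ratio c lam 2 0) (at_right 0)"
    using assms unfolding perturbation_ratio_def by (auto intro!: tendsto_eq_intros)
  moreover have "perturbation_ratio c lam 2 0 < 1"
    using assms by (simp add: perturbation_ratio_def)
  ultimately have "eventually (\<lambda>eps. perturbation_ratio c lam 2 eps < 1) (at_right 0)"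
    by (rule order_tendstoD)
  moreover have "((\<lambda>eps. 1 - 2 * eps - eps * K) \<longlongrightarrow> 1 - 2 * 0 - 0 * K) (at_right 0)"
    by (intro tendsto_intros)
  then have "eventually (\<lambda>eps. 0 < 1 - 2 * eps - eps * K) (at_right 0)"
    by (rule order_tendstoD) simp
  moreover have "eventually (\<lambda>eps::real. 0 < eps) (at_right 0)"
    by (rule eventually_at_right_less)
  ultimately have "eventually (\<lambda>eps. perturbation_ratio c lam 2 eps < 1 \<and>
      0 < 1 - 2 * eps - eps * K \<and> 0 < eps) (at_right 0)"
    by (intro eventually_conj)
  then obtain eps where eps: "perturbation_ratio c lam 2 eps < 1" "0 < 1 - 2 * eps - eps * K" "0 < eps"
    using eventually_happens' trivial_limit_at_right_real by blast
  \<comment> \<open>The largest \<open>r\<close> that the three conditions of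
    \<open>liapunov_rateI\<close> allow.\<close>
  define r where "r = min (2 * (1 - 2 * eps - eps * K)) (min (2 * eps) (eps * (1/2) * (lam - c) / lam))"
  have "r \<le> eps * (1/2) * (lam - c) / lam" by (simp add: r_def)
  then have "r * lam \<le> eps * (1 - 1/2) * (2 - 1) * (lam - c)"
    using assms by (simp add: field_simps)
  moreover have "0 < r" using assms eps by (simp add: r_def)
  moreover have "r / 2 \<le> 1 - 2 * eps - eps * K" "r / 2 \<le> eps" by (auto simp: r_def)
  ultimately have "liapunov_rate c lam (r / (1 + perturbation_ratio c lam 2 eps))"
    using assms eps by (intro liapunov_rateI[where \<theta> = "1/2"]) (auto simp: K_def)
  then show ?thesis by (rule that)
qed

section \<open>Exponential decay of solutions\<close>

text \<open>Gronwall's argument: \<open>exp (k * t) * f t\<close> has nonpositive derivative, and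
  the mean value theorem on \<open>[0, t]\<close> compares its end values. Only derivatives within
  the interval are used, which suits the one-sided derivative at \<open>0\<close>.\<close>

lemma exp_decay_of_derivative_le:
  fixes f :: "real \<Rightarrow> real"
  assumes "\<And>t. t \<ge> 0 \<Longrightarrow> \<exists>D. (f has_real_derivative D) (at t within {0..}) \<and> D \<le> - k * f t"
    and "t \<ge> 0"
  shows "f t \<le> exp (- k * t) * f 0"
proof (cases "t = 0")
  case False
  then have t: "0 < t" using assms by simp
  obtain D where D: "\<And>s. s \<ge> 0 \<Longrightarrow> (f has_real_derivative D s) (at s within {0..})"
    "\<And>s. s \<ge> 0 \<Longrightarrow> D s \<le> - k * f s"
    using assms(1) by metis
  have "\<exists>s\<in>{0<..<t}. exp (k * t) * f t - exp (k * 0) * f 0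
      = (\<lambda>h. (exp (k * s) * (D s + k * f s)) * h) (t - 0)"
  proof (rule mvt_simple[OF t])
    fix s assume s: "0 \<le> s" "s \<le> t"
    have "(f has_real_derivative D s) (at s within {0..t})"
      using D(1)[OF s(1)] by (rule has_field_derivative_subset) auto
    then have "((\<lambda>s. exp (k * s) * f s) has_real_derivative exp (k * s) * (D s + k * f s))
        (at s within {0..t})"
      by (auto intro!: derivative_eq_intros simp: algebra_simps)
    then show "((\<lambda>s. exp (k * s) * f s) has_derivative (\<lambda>h. exp (k * s) * (D s + k * f s) * h))
        (at s within {0..t})"
      by (simp add: has_field_derivative_def)
  qed
  then obtain s where s: "0 < s" "exp (k * t) * f t - f 0 = exp (k * s) * (D s + k * f s) * t"
    by auto
  have "exp (k * s) * (D s + k * f s) * t \<le> 0"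
    using D(2)[of s] s t by (intro mult_nonpos_nonneg mult_nonneg_nonpos) auto
  then have "exp (k * t) * f t \<le> f 0" using s by simp
  then show ?thesis by (simp add: exp_minus field_simps)
qed simp

text \<open>\<open>liapunov_H\<close> decays at rate \<open>\<delta>\<close> and is comparable to
  the squared norm, so taking roots halves the rate. The constant \<open>sqrt (M / m)\<close> is the
  same for all solutions.\<close>

lemma liapunov_rate_decay:
  assumes "liapunov_rate c lam \<delta>"
  obtains B where "B \<ge> 0"
    "\<And>u v u' v' t. solution c lam u v u' v' \<Longrightarrow> t \<ge> 0 \<Longrightarrow>
       norm (state u v u' v' t) \<le> B * exp (- (\<delta> / 2) * t) * norm (state u v u' v' 0)"
proof -
  obtain p eps \<theta> K m M where m: "m > 0" and M: "M > 0" and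
    H: "\<And>x. m * (norm x)\<^sup>2 \<le> liapunov_H c lam p eps x" "\<And>x. liapunov_H c lam p eps x \<le> M * (norm x)\<^sup>2" and
    D: "\<forall>u v u' v'. solution c lam u v u' v' \<longrightarrow>
        (\<forall>t\<ge>0. \<exists>D.
          ((\<lambda>s. liapunov_H c lam p eps (state u v u' v' s)) has_real_derivative D)
            (at t within {0..}) \<and>
          D \<le> derivative_estimate c lam p eps \<theta> K (state u v u' v' t) \<and>
          derivative_estimate c lam p eps \<theta> K (state u v u' v' t)
            \<le> - \<delta> * liapunov_H c lam p eps (state u v u' v' t))"
    using assms unfolding liapunov_rate_def by metis
  show ?thesis
  proof (rule that)
    show "sqrt (M / m) \<ge> 0" using m M by simp
    fix u v u' v' and t :: real
    assume sol: "solution c lam u v u' v'" and t: "t \<ge> 0"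
    let ?x = "state u v u' v'"
    have "liapunov_H c lam p eps (?x t) \<le> exp (- \<delta> * t) * liapunov_H c lam p eps (?x 0)"
    proof (rule exp_decay_of_derivative_le[OF _ t])
      fix s :: real
      assume "s \<ge> 0"
      then show "\<exists>D. ((\<lambda>s. liapunov_H c lam p eps (?x s)) has_real_derivative D) (at s within {0..}) \<and>
          D \<le> - \<delta> * liapunov_H c lam p eps (?x s)"
        using D sol by (blast intro: order_trans)
    qed
    also have "\<dots> \<le> exp (- \<delta> * t) * (M * (norm (?x 0))\<^sup>2)"
      using H by (intro mult_left_mono) auto
    finally have "m * (norm (?x t))\<^sup>2 \<le> exp (- \<delta> * t) * (M * (norm (?x 0))\<^sup>2)"
      using H(1)[of "?x t"] by linarith
    then have "(norm (?x t))\<^sup>2 \<le> M / m * exp (- \<delta> * t) * (norm (?x 0))\<^sup>2"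
      using m by (simp add: field_simps)
    also have "\<dots> = (sqrt (M / m) * exp (- (\<delta> / 2) * t) * norm (?x 0))\<^sup>2"
      using m M by (simp add: power_mult_distrib exp_double[symmetric])
    finally show "norm (?x t) \<le> sqrt (M / m) * exp (- (\<delta> / 2) * t) * norm (?x 0)"
      by (rule power2_le_imp_le) (use m M in auto)
  qed
qed

section \<open>Existence of solutions by power series\<close>

text \<open>These are the vectors \<open>A^n x\<close> for the matrix \<open>A\<close> of the
  equivalent first-order system; the factor \<open>1 / fact n\<close> is supplied where the series
  is formed.\<close>

primrec taylor_coeff :: "real \<Rightarrow> real \<Rightarrow> real ^ 4 \<Rightarrow> nat \<Rightarrow> real ^ 4" where
  "taylor_coeff c lam x 0 = x"
| "taylor_coeff c lam x (Suc n) = (let y = taylor_coeff c lam x n in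
    vector [y $ 3, y $ 4, - y $ 3 - lam * y $ 1 - c * y $ 2, - lam * y $ 2 - c * y $ 1])"

text \<open>No row of \<open>A\<close> has absolute sum above
  \<open>1 + \<bar>lam\<bar> + \<bar>c\<bar>\<close>, so each step multiplies the maximum of the
  components by at most that number.\<close>

lemma taylor_coeff_bound:
  "\<bar>taylor_coeff c lam x n $ i\<bar> \<le> norm x * (1 + \<bar>lam\<bar> + \<bar>c\<bar>) ^ n"
proof (induction n arbitrary: i)
  case 0
  then show ?case by (simp add: component_le_norm_cart)
next
  case (Suc n)
  define y where "y = taylor_coeff c lam x n"
  define b where "b = norm x * (1 + \<bar>lam\<bar> + \<bar>c\<bar>) ^ n"
  have y: "\<bar>y $ i\<bar> \<le> b" for i using Suc.IH by (simp add: y_def b_def)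
  have b: "b \<ge> 0" using y[of 1] by linarith
  have l: "\<bar>lam * y $ i\<bar> \<le> \<bar>lam\<bar> * b" "\<bar>c * y $ i\<bar> \<le> \<bar>c\<bar> * b" for i
    using y[of i] by (simp_all add: abs_mult mult_left_mono)
  have "\<bar>lam\<bar> * b \<ge> 0" "\<bar>c\<bar> * b \<ge> 0" using b by simp_all
  then have "\<forall>i. \<bar>taylor_coeff c lam x (Suc n) $ i\<bar> \<le> b + \<bar>lam\<bar> * b + \<bar>c\<bar> * b"
    using y[of 3] y[of 4] l(1)[of 1] l(1)[of 2] l(2)[of 1] l(2)[of 2] b
    unfolding forall_4 taylor_coeff.simps Let_def vector_4 y_def[symmetric]
    by (intro conjI; linarith)
  then show ?case by (simp add: b_def algebra_simps)
qed

lemma summable_taylor_coeff: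
  "summable (\<lambda>n. taylor_coeff c lam x n $ i / fact n * (t :: real) ^ n)"
proof (rule summable_comparison_test)
  show "\<exists>N. \<forall>n\<ge>N. norm (taylor_coeff c lam x n $ i / fact n * t ^ n)
      \<le> norm x * (inverse (fact n) * ((1 + \<bar>lam\<bar> + \<bar>c\<bar>) * \<bar>t\<bar>) ^ n)"
  proof (intro exI allI impI)
    fix n
    show "norm (taylor_coeff c lam x n $ i / fact n * t ^ n)
      \<le> norm x * (inverse (fact n) * ((1 + \<bar>lam\<bar> + \<bar>c\<bar>) * \<bar>t\<bar>) ^ n)"
      using mult_right_mono[OF taylor_coeff_bound[of c lam x n i], of "\<bar>t\<bar> ^ n / fact n"]
      by (simp add: abs_mult power_abs power_mult_distrib divide_inverse ac_simps)
  qed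
  show "summable (\<lambda>n. norm x * (inverse (fact n) * ((1 + \<bar>lam\<bar> + \<bar>c\<bar>) * \<bar>t\<bar>) ^ n))"
    by (intro summable_mult summable_exp)
qed

text \<open>The components of the matrix exponential series applied to \<open>x\<close> form the
  solution, since termwise differentiation amounts to applying \<open>A\<close>.\<close>

lemma solution_exists:
  obtains u v u' v' where "solution c lam u v u' v'" "state u v u' v' 0 = x"
proof -
  let ?a = "taylor_coeff c lam x"
  define f where "f i t = (\<Sum>n. ?a n $ i / fact n * t ^ n)" for i t
  have sums: "(\<lambda>n. ?a n $ i / fact n * t ^ n) sums f i t" for i t
    unfolding f_def by (rule summable_sums[OF summable_taylor_coeff])
  \<comment> \<open>\<open>diffs\<close> multiplies by \<open>n + 1\<close>, which cancels one
    factor of \<open>fact (Suc n)\<close> and leaves a pure index shift.\<close>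
  have diffs: "diffs (\<lambda>n. ?a n $ i / fact n) = (\<lambda>n. ?a (Suc n) $ i / fact n)" for i
    by (simp add: diffs_def fun_eq_iff)
  have deriv: "(f i has_real_derivative (\<Sum>n. ?a (Suc n) $ i / fact n * t ^ n)) (at t)" for i t
    using termdiffs_strong_converges_everywhere[OF summable_taylor_coeff, of c lam x i t]
    unfolding diffs f_def .
  \<comment> \<open>The shifted series of components \<open>1\<close> and \<open>2\<close> are
    \<open>f 3\<close> and \<open>f 4\<close> by the recursion; only the two velocity components
    need the equations.\<close>
  have 3: "(\<lambda>n. ?a (Suc n) $ 3 / fact n * t ^ n) sums (- f 3 t - lam * f 1 t - c * f 2 t)" for t
    using sums_diff[OF sums_diff[OF sums_minus[OF sums[of 3 t]] sums_mult[OF sums[of 1 t], of lam]]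
        sums_mult[OF sums[of 2 t], of c]]
    by (rule sums_cong[THEN iffD1, rotated]) (simp add: Let_def diff_divide_distrib left_diff_distrib)
  have 4: "(\<lambda>n. ?a (Suc n) $ 4 / fact n * t ^ n) sums (- (lam * f 2 t) - c * f 1 t)" for t
    using sums_diff[OF sums_minus[OF sums_mult[OF sums[of 2 t], of lam]]
        sums_mult[OF sums[of 1 t], of c]]
    by (rule sums_cong[THEN iffD1, rotated]) (simp add: Let_def diff_divide_distrib left_diff_distrib)
  have d: "(f 1 has_real_derivative f 3 t) (at t)" "(f 2 has_real_derivative f 4 t) (at t)"
    "(f 3 has_real_derivative - f 3 t - lam * f 1 t - c * f 2 t) (at t)"
    "(f 4 has_real_derivative - (lam * f 2 t) - c * f 1 t) (at t)" for t
    using deriv[of 1 t] deriv[of 2 t] deriv[of 3 t] deriv[of 4 t]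
      sums_unique[OF 3, symmetric] sums_unique[OF 4, symmetric]
    unfolding f_def by (simp_all add: Let_def)
  have "solution c lam (f 1) (f 2) (f 3) (f 4)"
    unfolding solution_def
  proof (intro allI impI conjI exI)
    fix t :: real
    show "(f 1 has_real_derivative f 3 t) (at t within {0..})"
      "(f 2 has_real_derivative f 4 t) (at t within {0..})"
      "(f 3 has_real_derivative - f 3 t - lam * f 1 t - c * f 2 t) (at t within {0..})"
      "(f 4 has_real_derivative - (lam * f 2 t) - c * f 1 t) (at t within {0..})"
      using d[of t] by (blast intro: DERIV_subset)+
  qed simp_all
  moreover have "f i 0 = x $ i" for i
    unfolding f_def by (subst powser_zero) simp
  then have "state (f 1) (f 2) (f 3) (f 4) 0 = x"
    by (simp add: vec_eq_iff forall_4)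
  ultimately show ?thesis by (rule that)
qed

section \<open>Uniqueness, linearity and boundedness of the semigroup\<close>

lemma solution_linear_combination:
  assumes "solution c lam u v u' v'" "solution c lam U V U' V'"
  shows "solution c lam (\<lambda>t. a * u t + b * U t) (\<lambda>t. a * v t + b * V t)
    (\<lambda>t. a * u' t + b * U' t) (\<lambda>t. a * v' t + b * V' t)"
  unfolding solution_def
proof (intro allI impI)
  fix t :: real
  assume t: "t \<ge> 0"
  obtain p q where 1:
    "(u has_real_derivative u' t) (at t within {0..})" "(v has_real_derivative v' t) (at t within {0..})"
    "(u' has_real_derivative p) (at t within {0..})" "(v' has_real_derivative q) (at t within {0..})"
    and e1: "p + u' t + lam * u t + c * v t = 0" "q + lam * v t + c * u t = 0"
    using assms(1) t unfolding solution_def by blast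
  obtain P Q where 2:
    "(U has_real_derivative U' t) (at t within {0..})" "(V has_real_derivative V' t) (at t within {0..})"
    "(U' has_real_derivative P) (at t within {0..})" "(V' has_real_derivative Q) (at t within {0..})"
    and e2: "P + U' t + lam * U t + c * V t = 0" "Q + lam * V t + c * U t = 0"
    using assms(2) t unfolding solution_def by blast
  have "(a * p + b * P) + (a * u' t + b * U' t) + lam * (a * u t + b * U t) + c * (a * v t + b * V t)
      = a * (p + u' t + lam * u t + c * v t) + b * (P + U' t + lam * U t + c * V t)"
    "(a * q + b * Q) + lam * (a * v t + b * V t) + c * (a * u t + b * U t)
      = a * (q + lam * v t + c * u t) + b * (Q + lam * V t + c * U t)"
    by (simp_all add: algebra_simps)
  then have e: "(a * p + b * P) + (a * u' t + b * U' t) + lam * (a * u t + b * U t) + c * (a * v t + b * V t) = 0"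
    "(a * q + b * Q) + lam * (a * v t + b * V t) + c * (a * u t + b * U t) = 0"
    unfolding e1 e2 by simp_all
  have d: "((\<lambda>t. a * u t + b * U t) has_real_derivative a * u' t + b * U' t) (at t within {0..})"
    "((\<lambda>t. a * v t + b * V t) has_real_derivative a * v' t + b * V' t) (at t within {0..})"
    "((\<lambda>t. a * u' t + b * U' t) has_real_derivative a * p + b * P) (at t within {0..})"
    "((\<lambda>t. a * v' t + b * V' t) has_real_derivative a * q + b * Q) (at t within {0..})"
    by (intro DERIV_add DERIV_cmult 1 2)+
  show "((\<lambda>t. a * u t + b * U t) has_real_derivative a * u' t + b * U' t) (at t within {0..}) \<and>
    ((\<lambda>t. a * v t + b * V t) has_real_derivative a * v' t + b * V' t) (at t within {0..}) \<and>
    (\<exists>A B. ((\<lambda>t. a * u' t + b * U' t) has_real_derivative A) (at t within {0..}) \<and>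
           ((\<lambda>t. a * v' t + b * V' t) has_real_derivative B) (at t within {0..}) \<and>
           A + (a * u' t + b * U' t) + lam * (a * u t + b * U t) + c * (a * v t + b * V t) = 0 \<and>
           B + lam * (a * v t + b * V t) + c * (a * u t + b * U t) = 0)"
    using d e by blast
qed

lemma state_linear_combination:
  "state (\<lambda>t. a * u t + b * U t) (\<lambda>t. a * v t + b * V t)
    (\<lambda>t. a * u' t + b * U' t) (\<lambda>t. a * v' t + b * V' t) t
    = a *\<^sub>R state u v u' v' t + b *\<^sub>R state U V U' V' t"
  by (simp add: vec_eq_iff forall_4)

text \<open>Uniqueness comes for free: the Liapunov decay forces a solution with zero initial state to vanish.\<close>

lemma semigroup_S_state:
  assumes "0 < c" "c < lam" "solution c lam u v u' v'" "t \<ge> 0"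
  shows "semigroup_S c lam t (state u v u' v' 0) = state u v u' v' t"
  unfolding semigroup_S_def
proof (rule the_equality)
  show "\<exists>U V U' V'. solution c lam U V U' V' \<and> state U V U' V' 0 = state u v u' v' 0 \<and>
      state U V U' V' t = state u v u' v' t"
    using assms(3) by blast
  fix y
  assume "\<exists>U V U' V'. solution c lam U V U' V' \<and> state U V U' V' 0 = state u v u' v' 0 \<and>
      state U V U' V' t = y"
  then obtain U V U' V' where U: "solution c lam U V U' V'" "state U V U' V' 0 = state u v u' v' 0"
    "state U V U' V' t = y"
    by blast
  obtain \<delta> B where decay: "\<And>u v u' v' t. solution c lam u v u' v' \<Longrightarrow> t \<ge> 0 \<Longrightarrow>
       norm (state u v u' v' t) \<le> B * exp (- (\<delta> / 2) * t) * norm (state u v u' v' 0)"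
    by (metis liapunov_rate_exists[OF assms(1,2)] liapunov_rate_decay)
  show "y = state u v u' v' t"
    using decay[OF solution_linear_combination[OF U(1) assms(3), of 1 "-1"] assms(4)] U
    unfolding state_linear_combination by simp
qed

lemma bounded_linear_semigroup_S:
  assumes "0 < c" "c < lam" "t \<ge> 0"
  shows "bounded_linear (semigroup_S c lam t)"
proof -
  have "semigroup_S c lam t (a *\<^sub>R x + b *\<^sub>R y) = a *\<^sub>R semigroup_S c lam t x + b *\<^sub>R semigroup_S c lam t y"
    for a b x y
  proof -
    obtain u v u' v' where 1: "solution c lam u v u' v'" "state u v u' v' 0 = x"
      by (rule solution_exists)
    obtain U V U' V' where 2: "solution c lam U V U' V'" "state U V U' V' 0 = y"
      by (rule solution_exists)
    show ?thesis
      using semigroup_S_state[OF assms(1,2) solution_linear_combination[OF 1(1) 2(1), of a b] assms(3)]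
        semigroup_S_state[OF assms(1,2) 1(1) assms(3)] semigroup_S_state[OF assms(1,2) 2(1) assms(3)]
      unfolding state_linear_combination 1 2 by simp
  qed
  \<comment> \<open>Taking \<open>a = b = 1\<close> gives additivity, and \<open>b = 0\<close> gives
    homogeneity.\<close>
  from this[of 1 _ 1] this[of _ _ 0] have "linear (semigroup_S c lam t)"
    by (intro linearI) simp_all
  then show ?thesis by (simp add: linear_conv_bounded_linear)
qed

text \<open>The decay constant is uniform in the initial state, so it bounds the operator norm. Thus
  half of every rate is an exponent competing in \<open>log_decrement\<close>.\<close>

lemma liapunov_rate_bounded:
  assumes "0 < c" "c < lam" "liapunov_rate c lam \<delta>"
  shows "bounded ((\<lambda>t. exp (\<delta> / 2 * t) * onorm (semigroup_S c lam t)) ` {0..})"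
proof -
  obtain B where B: "B \<ge> 0" "\<And>u v u' v' t. solution c lam u v u' v' \<Longrightarrow> t \<ge> 0 \<Longrightarrow>
       norm (state u v u' v' t) \<le> B * exp (- (\<delta> / 2) * t) * norm (state u v u' v' 0)"
    using liapunov_rate_decay[OF assms(3)] by blast
  have "norm (exp (\<delta> / 2 * t) * onorm (semigroup_S c lam t)) \<le> B" if t: "t \<ge> 0" for t
  proof -
    have "onorm (semigroup_S c lam t) \<le> B * exp (- (\<delta> / 2) * t)"
    proof (rule onorm_bound)
      fix x
      obtain u v u' v' where 1: "solution c lam u v u' v'" "state u v u' v' 0 = x"
        by (rule solution_exists)
      show "norm (semigroup_S c lam t x) \<le> B * exp (- (\<delta> / 2) * t) * norm x"
        using B(2)[OF 1(1) t] semigroup_S_state[OF assms(1,2) 1(1) t] 1(2) by simp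
    qed (use B in simp)
    then have "exp (\<delta> / 2 * t) * onorm (semigroup_S c lam t)
        \<le> exp (\<delta> / 2 * t) * (B * exp (- (\<delta> / 2) * t))"
      by (intro mult_left_mono) auto
    also have "\<dots> = B" by (simp add: exp_minus)
    finally show ?thesis
      using onorm_pos_le[OF bounded_linear_semigroup_S[OF assms(1,2) t]] by simp
  qed
  then show ?thesis by (intro boundedI[of _ B]) auto
qed

section \<open>The spectral upper bound\<close>

lemma characteristic_root:
  fixes c lam :: real
  obtains s :: complex where "(s\<^sup>2 + s + lam) * (s\<^sup>2 + lam) = c\<^sup>2" "Re s \<ge> - 1/4"
proof -
  let ?l = "complex_of_real lam" and ?c = "complex_of_real c"
  \<comment> \<open>The expanded characteristic polynomial, constant term first; the entry that
    matters is the \<open>1\<close> at degree 3.\<close>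
  define q where "q = [:?l\<^sup>2 - ?c\<^sup>2, ?l, 2 * ?l, 1, 1:]"
  have q: "q \<noteq> 0" "degree q = 4" "lead_coeff q = 1" "coeff q 3 = 1"
    by (simp_all add: q_def numeral_3_eq_3)
  \<comment> \<open>The multiset of roots is unpacked into four named elements so that Vieta's
    formula for the cubic coefficient is a direct computation.\<close>
  obtain A where A: "size A = 4" "q = (\<Prod>x\<in>#A. [:-x, 1:])"
    using alg_closed_imp_factorization[OF q(1)] q by auto
  obtain a A1 where A1: "A = add_mset a A1" "size A1 = 3"
    using A(1) size_eq_Suc_imp_eq_union[of A 3] by auto
  obtain b A2 where A2: "A1 = add_mset b A2" "size A2 = 2"
    using A1(2) size_eq_Suc_imp_eq_union[of A1 2] by auto
  obtain d A3 where A3: "A2 = add_mset d A3" "size A3 = 1"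
    using A2(2) size_eq_Suc_imp_eq_union[of A2 1] by auto
  obtain e where "A3 = {#e#}"
    using A3(2) size_1_singleton_mset by blast
  then have abde: "A = {#a, b, d, e#}" using A1 A2 A3 by simp
  have "coeff q 3 = - (a + b + d + e)"
    unfolding A(2) abde by (simp add: numeral_3_eq_3 algebra_simps)
  with q(4) have "Re (a + b + d + e) = - 1"
    by (metis add.inverse_inverse one_complex.sel(1) uminus_complex.sel(1))
  then have "\<exists>s\<in>{a, b, d, e}. Re s \<ge> - 1/4" by auto
  then obtain s where s: "s \<in> {a, b, d, e}" "Re s \<ge> - 1/4" by blast
  have "poly q s = 0" using s(1) unfolding A(2) abde by (auto simp: algebra_simps)
  then have "(s\<^sup>2 + s + lam) * (s\<^sup>2 + lam) = c\<^sup>2"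
    by (simp add: q_def algebra_simps power2_eq_square)
  then show ?thesis using s(2) that by blast
qed

text \<open>The hypotheses put \<open>(\<alpha>, \<beta>)\<close> in the kernel of the
  characteristic matrix at \<open>s\<close>. As the coefficients of the system are real, real parts
  of complex exponential solutions are again solutions.\<close>

lemma solution_exp:
  fixes s \<alpha> \<beta> :: complex
  assumes "(s\<^sup>2 + s + lam) * \<alpha> + c * \<beta> = 0" "(s\<^sup>2 + lam) * \<beta> + c * \<alpha> = 0"
  shows "solution c lam (\<lambda>t. Re (\<alpha> * exp (s * t))) (\<lambda>t. Re (\<beta> * exp (s * t)))
    (\<lambda>t. Re (s * \<alpha> * exp (s * t))) (\<lambda>t. Re (s * \<beta> * exp (s * t)))"
  unfolding solution_def
proof (intro allI impI)
  fix t :: real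
  have d: "((\<lambda>t. Re (z * exp (s * t))) has_real_derivative Re (s * z * exp (s * t))) (at t within {0..})" for z
  proof -
    have "((\<lambda>w. z * exp (s * w)) has_field_derivative s * z * exp (s * t)) (at (complex_of_real t))"
      by (rule derivative_eq_intros refl)+ simp
    from has_vector_derivative_real_field[OF this]
    have "((\<lambda>t. z * exp (s * complex_of_real t)) has_vector_derivative s * z * exp (s * t))
        (at t within {0..})" .
    from bounded_linear.has_vector_derivative[OF bounded_linear_Re this]
    show ?thesis by (simp add: has_real_derivative_iff_has_vector_derivative)
  qed
  define w where "w = exp (s * t)"
  have "Re (s * (s * \<alpha>) * w) + Re (s * \<alpha> * w) + lam * Re (\<alpha> * w) + c * Re (\<beta> * w)
      = Re (((s\<^sup>2 + s + lam) * \<alpha> + c * \<beta>) * w)"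
    "Re (s * (s * \<beta>) * w) + lam * Re (\<beta> * w) + c * Re (\<alpha> * w) = Re (((s\<^sup>2 + lam) * \<beta> + c * \<alpha>) * w)"
    by (simp_all add: algebra_simps power2_eq_square)
  then have "Re (s * (s * \<alpha>) * w) + Re (s * \<alpha> * w) + lam * Re (\<alpha> * w) + c * Re (\<beta> * w) = 0"
    "Re (s * (s * \<beta>) * w) + lam * Re (\<beta> * w) + c * Re (\<alpha> * w) = 0"
    unfolding assms by simp_all
  then show "((\<lambda>t. Re (\<alpha> * exp (s * t))) has_real_derivative Re (s * \<alpha> * exp (s * t))) (at t within {0..}) \<and>
    ((\<lambda>t. Re (\<beta> * exp (s * t))) has_real_derivative Re (s * \<beta> * exp (s * t))) (at t within {0..}) \<and>
    (\<exists>a b. ((\<lambda>t. Re (s * \<alpha> * exp (s * t))) has_real_derivative a) (at t within {0..}) \<and>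
           ((\<lambda>t. Re (s * \<beta> * exp (s * t))) has_real_derivative b) (at t within {0..}) \<and>
           a + Re (s * \<alpha> * exp (s * t)) + lam * Re (\<alpha> * exp (s * t)) + c * Re (\<beta> * exp (s * t)) = 0 \<and>
           b + lam * Re (\<beta> * exp (s * t)) + c * Re (\<alpha> * exp (s * t)) = 0)"
    using d unfolding w_def by blast
qed

text \<open>An exponential solution for a root with \<open>Re s \<ge> - 1/4\<close> grows like
  \<open>exp (Re s * t)\<close>, so boundedness forces
  \<open>\<gamma> + Re s \<le> 0\<close>.\<close>

lemma bounded_exponent_le:
  assumes c: "0 < c" "c < lam"
    and bdd: "bounded ((\<lambda>t. exp (\<gamma> * t) * onorm (semigroup_S c lam t)) ` {0..})"
  shows "\<gamma> \<le> 1/4"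
proof -
  obtain s :: complex where s: "(s\<^sup>2 + s + lam) * (s\<^sup>2 + lam) = c\<^sup>2" "Re s \<ge> - 1/4"
    by (rule characteristic_root)
  \<comment> \<open>The kernel vector is \<open>(c, \<beta>)\<close>; its first entry is nonzero, so
    \<open>u\<close> alone detects the growth.\<close>
  define \<beta> where "\<beta> = - (s\<^sup>2 + s + lam)"
  obtain B where "\<forall>t\<ge>0. norm (exp (\<gamma> * t) * onorm (semigroup_S c lam t)) \<le> B"
    using bdd by (auto simp: bounded_iff)
  then have B: "exp (\<gamma> * t) * onorm (semigroup_S c lam t) \<le> B" if "t \<ge> 0" for t
    using that abs_ge_self order_trans unfolding real_norm_def by blast
  \<comment> \<open>A single real part may vanish at some times. The factors \<open>1\<close> and
    \<open>\<i>\<close> for \<open>\<zeta>\<close> give, up to sign, the real and imaginary parts of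
    one complex solution, which together control its modulus.\<close>
  define x where "x \<zeta> = state (\<lambda>t. Re (\<zeta> * c * exp (s * t))) (\<lambda>t. Re (\<zeta> * \<beta> * exp (s * t)))
    (\<lambda>t. Re (s * (\<zeta> * c) * exp (s * t))) (\<lambda>t. Re (s * (\<zeta> * \<beta>) * exp (s * t)))" for \<zeta> :: complex
  have sol: "exp (\<gamma> * t) * \<bar>Re (\<zeta> * c * exp (s * t))\<bar> \<le> B * norm (x \<zeta> 0)"
    if t: "t \<ge> 0" for \<zeta> :: complex and t :: real
  proof -
    have "(s\<^sup>2 + s + lam) * (\<zeta> * c) + c * (\<zeta> * \<beta>) = 0"
      by (simp add: \<beta>_def algebra_simps)
    moreover have "(s\<^sup>2 + lam) * (\<zeta> * \<beta>) + c * (\<zeta> * c) = \<zeta> * (c\<^sup>2 - (s\<^sup>2 + s + lam) * (s\<^sup>2 + lam))"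
      by (simp add: \<beta>_def algebra_simps power2_eq_square)
    then have "(s\<^sup>2 + lam) * (\<zeta> * \<beta>) + c * (\<zeta> * c) = 0" using s by simp
    ultimately have "semigroup_S c lam t (x \<zeta> 0) = x \<zeta> t"
      unfolding x_def by (intro semigroup_S_state[OF c solution_exp t])
    then have "norm (x \<zeta> t) \<le> onorm (semigroup_S c lam t) * norm (x \<zeta> 0)"
      using onorm[OF bounded_linear_semigroup_S[OF c t], of "x \<zeta> 0"] by simp
    moreover have "\<bar>Re (\<zeta> * c * exp (s * t))\<bar> \<le> norm (x \<zeta> t)"
      using component_le_norm_cart[of "x \<zeta> t" 1] by (simp add: x_def)
    ultimately have "\<bar>Re (\<zeta> * c * exp (s * t))\<bar> \<le> onorm (semigroup_S c lam t) * norm (x \<zeta> 0)"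
      by linarith
    then have "exp (\<gamma> * t) * \<bar>Re (\<zeta> * c * exp (s * t))\<bar>
        \<le> exp (\<gamma> * t) * (onorm (semigroup_S c lam t) * norm (x \<zeta> 0))"
      by (intro mult_left_mono) auto
    also have "\<dots> \<le> B * norm (x \<zeta> 0)"
      using mult_right_mono[OF B[OF t], of "norm (x \<zeta> 0)"] by (simp add: mult.assoc)
    finally show ?thesis .
  qed
  define C where "C = B * norm (x 1 0) + B * norm (x \<i> 0)"
  have bound: "exp ((\<gamma> + Re s) * t) \<le> C / c" if t: "t \<ge> 0" for t
  proof -
    have "exp (\<gamma> * t) * (c * exp (Re s * t)) = exp (\<gamma> * t) * norm (c * exp (s * t))"
      using c by (simp add: norm_mult)
    also have "\<dots> \<le> exp (\<gamma> * t) * (\<bar>Re (1 * c * exp (s * t))\<bar> + \<bar>Re (\<i> * c * exp (s * t))\<bar>)"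
      using cmod_le[of "c * exp (s * t)"] by (intro mult_left_mono) (auto simp: mult.assoc)
    also have "\<dots> \<le> C" using sol[OF t, of 1] sol[OF t, of \<i>] by (simp add: C_def algebra_simps)
    finally show ?thesis using c by (simp add: field_simps exp_add)
  qed
  have "\<gamma> + Re s \<le> 0"
  proof (rule ccontr)
    assume "\<not> \<gamma> + Re s \<le> 0"
    then have pos: "\<gamma> + Re s > 0" by simp
    \<comment> \<open>At this time the exponent equals \<open>\<bar>C / c\<bar>\<close>, and
      \<open>1 + y \<le> exp y\<close> already exceeds the bound.\<close>
    define t where "t = \<bar>C / c\<bar> / (\<gamma> + Re s)"
    have "t \<ge> 0" using pos by (simp add: t_def)
    from order_trans[OF exp_ge_add_one_self bound[OF this]]
    have "1 + (\<gamma> + Re s) * t \<le> C / c" .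
    moreover have "(\<gamma> + Re s) * t = \<bar>C / c\<bar>" using pos by (simp add: t_def)
    ultimately show False by linarith
  qed
  then show ?thesis using s(2) by simp
qed

section \<open>Bounds for the two decrements, and their limit\<close>

lemma liapunov_rate_le_log_decrement:
  assumes "0 < c" "c < lam" "liapunov_rate c lam \<delta>"
  shows "\<delta> / 2 \<le> log_decrement c lam"
  unfolding log_decrement_def
proof (rule cSup_upper)
  have "\<delta> > 0" using assms(3) by (simp add: liapunov_rate_def)
  then show "\<delta> / 2 \<in> {\<gamma>. \<gamma> > 0 \<and> bounded ((\<lambda>t. exp (\<gamma> * t) * onorm (semigroup_S c lam t)) ` {0..})}"
    using liapunov_rate_bounded[OF assms] by simp
  show "bdd_above {\<gamma>. \<gamma> > 0 \<and> bounded ((\<lambda>t. exp (\<gamma> * t) * onorm (semigroup_S c lam t)) ` {0..})}"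
    using bounded_exponent_le[OF assms(1,2)] by (intro bdd_aboveI[of _ "1/4"]) auto
qed

lemma log_decrement_le:
  assumes "0 < c" "c < lam"
  shows "log_decrement c lam \<le> 1/4"
  unfolding log_decrement_def
proof (rule cSup_least)
  obtain \<delta> where \<delta>: "liapunov_rate c lam \<delta>"
    using assms by (rule liapunov_rate_exists)
  then have "\<delta> > 0" by (simp add: liapunov_rate_def)
  then show "{\<gamma>. \<gamma> > 0 \<and> bounded ((\<lambda>t. exp (\<gamma> * t) * onorm (semigroup_S c lam t)) ` {0..})} \<noteq> {}"
    using liapunov_rate_bounded[OF assms \<delta>] by (auto intro!: exI[of _ "\<delta> / 2"])
qed (use bounded_exponent_le[OF assms] in blast)

text \<open>The method never overshoots: each \<open>\<delta> / 2\<close> lies below the true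
  decrement, which is at most \<open>1/4\<close>.\<close>

lemma liapunov_decrement_le:
  assumes "0 < c" "c < lam"
  shows "liapunov_decrement c lam \<le> 1/4"
  unfolding liapunov_decrement_def
proof (rule cSup_least)
  show "{\<delta> / 2 | \<delta>. liapunov_rate c lam \<delta>} \<noteq> {}"
    using liapunov_rate_exists[OF assms] by blast
qed (use liapunov_rate_le_log_decrement[OF assms] log_decrement_le[OF assms] in fastforce)

lemma liapunov_rate_le_liapunov_decrement:
  assumes "0 < c" "c < lam" "liapunov_rate c lam \<delta>"
  shows "\<delta> / 2 \<le> liapunov_decrement c lam"
  unfolding liapunov_decrement_def
proof (rule cSup_upper)
  show "bdd_above {\<delta> / 2 | \<delta>. liapunov_rate c lam \<delta>}"
    using liapunov_rate_le_log_decrement[OF assms(1,2)] log_decrement_le[OF assms(1,2)]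
    by (intro bdd_aboveI[of _ "1/4"]) fastforce
qed (use assms in blast)

text \<open>The choice \<open>p = 3\<close>, \<open>eps = 1/4\<close> balances the leading coefficients of the estimate:
  \<open>1 - p * eps = eps = eps * (p - 1) / 2 = 1/4\<close>.\<close>

lemma eventually_liapunov_rate:
  fixes c lam :: "'a \<Rightarrow> real"
  assumes pos: "eventually (\<lambda>i. 0 < c i \<and> c i < lam i) F"
    and small: "((\<lambda>i. c i / lam i) \<longlongrightarrow> 0) F"
    and large: "filterlim (\<lambda>i. c i / sqrt (lam i)) at_top F"
    and a: "a < 1/4"
  shows "eventually (\<lambda>i. \<exists>\<delta>. liapunov_rate (c i) (lam i) \<delta> \<and> a < \<delta> / 2) F"
proof -
  \<comment> \<open>The evaluations will tend to \<open>(1 - \<theta>) / 4\<close>, and this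
    \<open>\<theta>\<close> places that limit midway between \<open>b\<close> and
    \<open>1/4\<close>. Replacing \<open>a\<close> by \<open>b \<ge> 0\<close> keeps
    \<open>\<theta>\<close> below \<open>1\<close>.\<close>
  define b where "b = max a 0"
  define \<theta> where "\<theta> = (1 - 4 * b) / 2"
  have b: "0 \<le> b" "b < 1/4" "a \<le> b" using a by (auto simp: b_def)
  have \<theta>: "0 < \<theta>" "\<theta> < 1" "b < (1 - \<theta>) / 4" using b by (auto simp: \<theta>_def field_simps)
  \<comment> \<open>For positive parameters \<open>g\<close> is \<open>sqrt lam / c\<close>. Of the
    three small quantities only \<open>w\<close> needs an argument: it equals \<open>h * g\<close>,
    so \<open>lam\<close> tends to infinity as a consequence of the two assumed limits.\<close>
  define g where "g i = inverse (c i / sqrt (lam i))" for i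
  define h where "h i = c i / lam i" for i
  define w where "w i = 1 / sqrt (lam i)" for i
  have h: "(h \<longlongrightarrow> 0) F" unfolding h_def by (rule small)
  have g: "(g \<longlongrightarrow> 0) F"
    unfolding g_def using large by (rule tendsto_inverse_0_at_top)
  have w: "(w \<longlongrightarrow> 0) F"
  proof (rule Lim_transform_eventually)
    show "((\<lambda>i. h i * g i) \<longlongrightarrow> 0) F" using tendsto_mult[OF h g] by simp
    show "eventually (\<lambda>i. h i * g i = w i) F"
      using pos
    proof eventually_elim
      case (elim i)
      then have "lam i = sqrt (lam i) * sqrt (lam i)" by simp
      then show ?case using elim by (simp add: g_def h_def w_def field_simps)
    qed
  qed
  have ratio: "((\<lambda>i. perturbation_ratio (c i) (lam i) 3 (1/4)) \<longlongrightarrow> 0) F"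
  proof (rule Lim_transform_eventually)
    \<comment> \<open>For \<open>p = 3\<close> the coefficient \<open>k\<close> is
      \<open>2 * lam / c\<close>, and \<open>k / sqrt lam = 2 * g\<close>.\<close>
    show "((\<lambda>i. h i + (1/4) * (3 * w i + 2 * g i)) \<longlongrightarrow> 0) F"
      using h g w by (auto intro!: tendsto_eq_intros)
    show "eventually (\<lambda>i. h i + (1/4) * (3 * w i + 2 * g i)
        = perturbation_ratio (c i) (lam i) 3 (1/4)) F"
      using pos
    proof eventually_elim
      case (elim i)
      then have "lam i = sqrt (lam i) * sqrt (lam i)" by simp
      then have "2 * lam i / c i / sqrt (lam i) = 2 * g i"
        using elim by (simp add: g_def field_simps)
      then show ?case by (simp add: perturbation_ratio_def h_def w_def add_divide_distrib)
    qed
  qed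
  have K: "((\<lambda>i. young_constant (c i) (lam i) 3 \<theta>) \<longlongrightarrow> 0) F"
  proof (rule Lim_transform_eventually)
    \<comment> \<open>Numerator and denominator of the Young constant for \<open>p = 3\<close>, each
      divided by \<open>lam\<close>.\<close>
    show "((\<lambda>i. (9 * (w i)\<^sup>2 + 4 * (g i)\<^sup>2) / (4 * \<theta> * (1 - h i))) \<longlongrightarrow> 0) F"
      using h g w \<theta> by (auto intro!: tendsto_eq_intros)
    show "eventually (\<lambda>i. (9 * (w i)\<^sup>2 + 4 * (g i)\<^sup>2) / (4 * \<theta> * (1 - h i))
        = young_constant (c i) (lam i) 3 \<theta>) F"
      using pos
    proof eventually_elim
      case (elim i)
      then have eqs: "(w i)\<^sup>2 = 1 / lam i" "h i = c i / lam i" "(g i)\<^sup>2 = lam i / (c i)\<^sup>2"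
        by (simp_all add: g_def h_def w_def power_divide)
      have "(9 * (1 / lam i) + 4 * (lam i / (c i)\<^sup>2)) = (3\<^sup>2 + (2 * lam i / c i)\<^sup>2) / lam i"
        using elim by (simp add: field_simps power2_eq_square)
      moreover have "4 * \<theta> * (1 - c i / lam i) = 4 * \<theta> * (lam i - c i) / lam i"
        using elim by (simp add: field_simps)
      ultimately show ?case using elim unfolding eqs young_constant_def by simp
    qed
  qed
  \<comment> \<open>The entries are the conditions of \<open>liapunov_rateI\<close> on the
    coefficients of \<open>u'^2\<close> and \<open>u^2 + v^2\<close>, solved for \<open>r\<close>.
    The condition \<open>r / 2 \<le> 1/4\<close> from \<open>v'^2\<close> follows from the second
    entry.\<close>
  define r where "r i = min ((1 - young_constant (c i) (lam i) 3 \<theta>) / 2) ((1 - \<theta>) * (1 - c i / lam i) / 2)" for i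
  have "(r \<longlongrightarrow> min ((1 - 0) / 2) ((1 - \<theta>) * (1 - 0) / 2)) F"
    unfolding r_def by (intro tendsto_intros K small) simp_all
  then have r: "(r \<longlongrightarrow> (1 - \<theta>) / 2) F" using \<theta> by (simp add: min_def)
  have "((\<lambda>i. r i / (1 + perturbation_ratio (c i) (lam i) 3 (1/4))) \<longlongrightarrow> (1 - \<theta>) / 2 / (1 + 0)) F"
    by (intro tendsto_intros r ratio) simp
  then have "eventually (\<lambda>i. 2 * b < r i / (1 + perturbation_ratio (c i) (lam i) 3 (1/4))) F"
    by (rule order_tendstoD) (use \<theta> in simp)
  moreover have "eventually (\<lambda>i. perturbation_ratio (c i) (lam i) 3 (1/4) < 1) F"
    by (rule order_tendstoD[OF ratio]) simp
  moreover have "eventually (\<lambda>i. 0 < r i) F"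
    by (rule order_tendstoD[OF r]) (use \<theta> in simp)
  ultimately show ?thesis
    using pos
  proof eventually_elim
    case (elim i)
    have r2: "r i \<le> (1 - \<theta>) * (1 - c i / lam i) / 2"
      unfolding r_def by (rule min.cobounded2)
    then have "r i * lam i \<le> (1 - \<theta>) * (1 - c i / lam i) / 2 * lam i"
      using elim r2 by (intro mult_right_mono) auto
    also have "\<dots> = 1 / 4 * (1 - \<theta>) * (3 - 1) * (lam i - c i)"
      using elim by (simp add: field_simps)
    finally have r3: "r i * lam i \<le> 1 / 4 * (1 - \<theta>) * (3 - 1) * (lam i - c i)" .
    have "(1 - \<theta>) * (1 - c i / lam i) \<le> 1 * 1"
      using elim \<theta> by (intro mult_mono) auto
    from order_trans[OF r2 divide_right_mono[OF this, of 2]] have "r i \<le> 1 / 2" by simp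
    moreover have "r i \<le> (1 - young_constant (c i) (lam i) 3 \<theta>) / 2"
      unfolding r_def by (rule min.cobounded1)
    ultimately have "liapunov_rate (c i) (lam i) (r i / (1 + perturbation_ratio (c i) (lam i) 3 (1/4)))"
      using elim \<theta> r3 by (intro liapunov_rateI) auto
    then show ?case using elim b by (intro exI conjI) auto
  qed
qed

text \<open>Families along an arbitrary filter express the joint limit in \<open>c\<close> and
  \<open>lam\<close> without fixing how it is approached. The same rates bound both decrements from
  below, and \<open>1/4\<close> bounds both from above.\<close>

theorem proposition4p1:
  fixes c lam :: "'a \<Rightarrow> real" and F :: "'a filter"
  assumes "eventually (\<lambda>i. 0 < c i \<and> c i < lam i) F"
    and "((\<lambda>i. c i / lam i) \<longlongrightarrow> 0) F"
    and "filterlim (\<lambda>i. c i / sqrt (lam i)) at_top F"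
  shows "((\<lambda>i. liapunov_decrement (c i) (lam i)) \<longlongrightarrow> 1/4) F
    \<and> ((\<lambda>i. log_decrement (c i) (lam i)) \<longlongrightarrow> 1/4) F
    \<and> (\<forall>k l. 0 < k \<and> k < l \<longrightarrow> log_decrement k l \<le> 1/4)"
proof (intro conjI)
  show "((\<lambda>i. liapunov_decrement (c i) (lam i)) \<longlongrightarrow> 1/4) F"
  proof (rule order_tendstoI)
    fix a :: real
    assume "a < 1/4"
    from eventually_liapunov_rate[OF assms this] assms(1)
    show "eventually (\<lambda>i. a < liapunov_decrement (c i) (lam i)) F"
      by eventually_elim (meson liapunov_rate_le_liapunov_decrement less_le_trans)
  next
    fix a :: real
    assume "1/4 < a"
    with assms(1) show "eventually (\<lambda>i. liapunov_decrement (c i) (lam i) < a) F"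
      by (auto elim!: eventually_mono intro: le_less_trans[OF liapunov_decrement_le])
  qed
  show "((\<lambda>i. log_decrement (c i) (lam i)) \<longlongrightarrow> 1/4) F"
  proof (rule order_tendstoI)
    fix a :: real
    assume "a < 1/4"
    from eventually_liapunov_rate[OF assms this] assms(1)
    show "eventually (\<lambda>i. a < log_decrement (c i) (lam i)) F"
      by eventually_elim (meson liapunov_rate_le_log_decrement less_le_trans)
  next
    fix a :: real
    assume "1/4 < a"
    with assms(1) show "eventually (\<lambda>i. log_decrement (c i) (lam i) < a) F"
      by (auto elim!: eventually_mono intro: le_less_trans[OF log_decrement_le])
  qed
  show "\<forall>k l. 0 < k \<and> k < l \<longrightarrow> log_decrement k l \<le> 1/4"
    using log_decrement_le by blast
qed

end
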